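(* Let $X$ be an Archimedean vector lattice with the principal projection property (PPP) and let $(x_\alpha)$ be a net in $X_+$. Then $(x_\alpha)$ uo-converges to $0$ in $X$ if and only if for every $u\in X$ with $u>0$ and every real $\varepsilon>0$ there exist a non-zero component $v$ of $u$ and an index $\alpha_0$ such that $P_v x_\alpha\leqslant\varepsilon u$ for all $\alpha\geqslant\alpha_0$.
   Context: $X_+$ is the set of non-negative elements of $X$. $X$ has the principal projection property (PPP) if every principal band of $X$ is a projection band; $P_v$ denotes the band projection onto the principal band generated by $v$. A component of $u\in X_+$ is an element $v$ with $0\leqslant v\leqslant u$ and $v\wedge(u-v)=0$. A net $(x_\alpha)$ in $X$ converges in order to $x$ if there is a net $(u_\gamma)$ in $X$, possibly with a different index set, such that $u_\gamma\downarrow 0$ (decreasing with infimum $0$ in $X$) and for every $\gamma$ there exists $\alpha_0$ with $|x_\alpha-x|\leqslant u_\gamma$ for all $\alpha\geqslant\alpha_0$. The net uo-converges to $x$ if for every $u\geqslant 0$ in $X$ the net $(|x_\alpha-x|\wedge u)$ converges in order to $0$. *)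

theory Defs
  imports Complex_Main "HOL-Library.Lattice_Algebras"
begin

class vector_lattice = ordered_real_vector + lattice_ab_group_add_abs

text \<open>
  The Archimedean property is the one for vector lattices; the library class of Archimedean
  fields is unrelated.
\<close>

definition archimedean_vl :: "'a::vector_lattice itself \<Rightarrow> bool" where
  "archimedean_vl TYPE('a) \<longleftrightarrow>
     (\<forall>x y::'a. 0 \<le> x \<longrightarrow> (\<forall>n::nat. real n *\<^sub>R x \<le> y) \<longrightarrow> x = 0)"

definition is_supremum :: "'a::order set \<Rightarrow> 'a \<Rightarrow> bool" where
  "is_supremum D s \<longleftrightarrow> (\<forall>d\<in>D. d \<le> s) \<and> (\<forall>z. (\<forall>d\<in>D. d \<le> z) \<longrightarrow> s \<le> z)"

definition is_infimum :: "'a::order set \<Rightarrow> 'a \<Rightarrow> bool" where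
  "is_infimum D s \<longleftrightarrow> (\<forall>d\<in>D. s \<le> d) \<and> (\<forall>z. (\<forall>d\<in>D. z \<le> d) \<longrightarrow> z \<le> s)"


subsection \<open>Bands and band projections\<close>

definition order_ideal :: "'a::vector_lattice set \<Rightarrow> bool" where
  "order_ideal B \<longleftrightarrow> subspace B \<and> (\<forall>x y. y \<in> B \<longrightarrow> \<bar>x\<bar> \<le> \<bar>y\<bar> \<longrightarrow> x \<in> B)"

definition band :: "'a::vector_lattice set \<Rightarrow> bool" where
  "band B \<longleftrightarrow> order_ideal B \<and> (\<forall>D s. D \<subseteq> B \<longrightarrow> is_supremum D s \<longrightarrow> s \<in> B)"

definition principal_band :: "'a::vector_lattice \<Rightarrow> 'a set" where
  "principal_band v = \<Inter>{B. band B \<and> v \<in> B}"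

definition disjoint_complement :: "'a::vector_lattice set \<Rightarrow> 'a set" where
  "disjoint_complement B = {x. \<forall>y\<in>B. inf \<bar>x\<bar> \<bar>y\<bar> = 0}"

text \<open>
  The unique existence below says that the space is the direct sum of \<^term>\<open>B\<close> and its disjoint
  complement.
\<close>

definition projection_band :: "'a::vector_lattice set \<Rightarrow> bool" where
  "projection_band B \<longleftrightarrow>
     band B \<and> (\<forall>x. \<exists>!y. y \<in> B \<and> x - y \<in> disjoint_complement B)"

text \<open>Meaningful only if \<^term>\<open>B\<close> is a projection band.\<close>

definition band_projection :: "'a::vector_lattice set \<Rightarrow> 'a \<Rightarrow> 'a" where
  "band_projection B x = (THE y. y \<in> B \<and> x - y \<in> disjoint_complement B)"

definition principal_projection_property :: "'a::vector_lattice itself \<Rightarrow> bool" where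
  "principal_projection_property TYPE('a) \<longleftrightarrow> (\<forall>v::'a. projection_band (principal_band v))"

definition is_component :: "'a::vector_lattice \<Rightarrow> 'a \<Rightarrow> bool" where
  "is_component u v \<longleftrightarrow> 0 \<le> v \<and> v \<le> u \<and> inf v (u - v) = 0"


subsection \<open>Nets, order convergence and unbounded order convergence\<close>

definition directed_set :: "'i set \<Rightarrow> ('i \<Rightarrow> 'i \<Rightarrow> bool) \<Rightarrow> bool" where
  "directed_set A le \<longleftrightarrow> A \<noteq> {} \<and> reflp_on A le \<and> transp_on A le \<and>
     (\<forall>\<alpha>\<in>A. \<forall>\<beta>\<in>A. \<exists>\<gamma>\<in>A. le \<alpha> \<gamma> \<and> le \<beta> \<gamma>)"

definition net_decreases_to :: "'g set \<Rightarrow> ('g \<Rightarrow> 'g \<Rightarrow> bool) \<Rightarrow> ('g \<Rightarrow> 'a::order) \<Rightarrow> 'a \<Rightarrow> bool" where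
  "net_decreases_to G leG w l \<longleftrightarrow> directed_set G leG \<and>
     (\<forall>\<gamma>\<in>G. \<forall>\<delta>\<in>G. leG \<gamma> \<delta> \<longrightarrow> w \<delta> \<le> w \<gamma>) \<and> is_infimum (w ` G) l"

definition net_dominated ::
    "'i set \<Rightarrow> ('i \<Rightarrow> 'i \<Rightarrow> bool) \<Rightarrow> ('i \<Rightarrow> 'a::vector_lattice) \<Rightarrow> 'a \<Rightarrow> 'g set \<Rightarrow> ('g \<Rightarrow> 'a) \<Rightarrow> bool" where
  "net_dominated A le x l G w \<longleftrightarrow>
     (\<forall>\<gamma>\<in>G. \<exists>\<alpha>\<^sub>0\<in>A. \<forall>\<alpha>\<in>A. le \<alpha>\<^sub>0 \<alpha> \<longrightarrow> \<bar>x \<alpha> - l\<bar> \<le> w \<gamma>)"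

text \<open>
  HOL cannot quantify existentially over the type of the index set of the dominating net. Here
  the index set is a subset of the vector lattice itself, with an arbitrary directed preorder.
  Nothing is lost: a decreasing net with any other index type can be replaced by its range, see
  \<open>order_convergesI\<close>.
\<close>

definition order_converges ::
    "'i set \<Rightarrow> ('i \<Rightarrow> 'i \<Rightarrow> bool) \<Rightarrow> ('i \<Rightarrow> 'a::vector_lattice) \<Rightarrow> 'a \<Rightarrow> bool" where
  "order_converges A le x l \<longleftrightarrow>
     (\<exists>(G::'a set) leG (w::'a \<Rightarrow> 'a). net_decreases_to G leG w 0 \<and> net_dominated A le x l G w)"

lemma order_convergesI:
  fixes G :: "'g set" and x :: "'i \<Rightarrow> 'a::vector_lattice"
  assumes dec: "net_decreases_to G leG w 0" and dom: "net_dominated A le x l G w"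
  shows "order_converges A le x l"
proof -
  have "\<exists>\<eta>\<in>G. w \<eta> \<le> w \<gamma> \<and> w \<eta> \<le> w \<delta>" if "\<gamma> \<in> G" "\<delta> \<in> G" for \<gamma> \<delta>
    using dec that unfolding net_decreases_to_def directed_set_def by meson
  moreover have "G \<noteq> {}"
    using dec by (simp add: net_decreases_to_def directed_set_def)
  ultimately have "directed_set (w ` G) (\<lambda>a b. b \<le> a)"
    by (auto simp: directed_set_def reflp_on_def transp_on_def)
  then have "net_decreases_to (w ` G) (\<lambda>a b. b \<le> a) (\<lambda>a. a) 0"
    using dec by (simp add: net_decreases_to_def)
  moreover have "net_dominated A le x l (w ` G) (\<lambda>a. a)"
    using dom by (simp add: net_dominated_def)
  ultimately show ?thesis
    unfolding order_converges_def by blast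
qed

definition uo_converges ::
    "'i set \<Rightarrow> ('i \<Rightarrow> 'i \<Rightarrow> bool) \<Rightarrow> ('i \<Rightarrow> 'a::vector_lattice) \<Rightarrow> 'a \<Rightarrow> bool" where
  "uo_converges A le x l \<longleftrightarrow>
     (\<forall>u\<ge>0. order_converges A le (\<lambda>\<alpha>. inf \<bar>x \<alpha> - l\<bar> u) 0)"

end

theory Submission
  imports Defs
begin

text \<open>
  Both directions rest on the fact that disjoint complements are bands
  (\<open>band_disjoint_complement\<close>), so that an element of the principal band of \<open>v\<close> which is disjoint
  from \<open>v\<close> is zero, and on the monotonicity of \<open>P\<close> and \<open>I - P\<close> for a band projection \<open>P\<close>.

  Suppose first that the net is uo-null and let \<open>u > 0\<close>. The net \<open>x\<^sub>\<alpha> \<and> 2\<epsilon>u\<close> is eventually below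
  each member of some net decreasing to zero. Some member \<open>w\<close> of it is not above \<open>\<epsilon>u\<close>, that is,
  \<open>z = (\<epsilon>u - w)\<^sup>+\<close> is non-zero. On the band of \<open>z\<close> one has \<open>w \<le> \<epsilon>u\<close>, so with the component
  \<open>v = P\<^sub>z u\<close> of \<open>u\<close> the element \<open>P\<^sub>v x\<^sub>\<alpha>\<close>, when truncated at \<open>2\<epsilon>v\<close>, is at most \<open>\<epsilon>v\<close>. The
  truncation at twice the bound can then be removed: the excess \<open>(P\<^sub>v x\<^sub>\<alpha> - \<epsilon>v)\<^sup>+\<close> is disjoint
  from \<open>v\<close> and lies in the band of \<open>v\<close>.

  Conversely, dominate \<open>x\<^sub>\<alpha> \<and> u\<close> by the downward directed set of all its non-negative eventual
  upper bounds; the point is that this set has infimum zero. If it had a lower bound \<open>h > 0\<close>, the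
  condition for \<open>h\<close> and \<open>\<epsilon> = 1/2\<close> would give a non-zero component \<open>v\<close> of \<open>h\<close> for which
  \<open>h/2 + (u - P\<^sub>v u)\<close> is an eventual upper bound. Then \<open>h/2 \<le> u - P\<^sub>v u\<close>, which makes \<open>h\<close>, and
  hence \<open>v\<close> itself, disjoint from \<open>v\<close>.
\<close>

section \<open>Inequalities in vector lattices\<close>

lemma inf_add_le:
  fixes a b c :: "'a::vector_lattice"
  assumes "0 \<le> a" "0 \<le> b" "0 \<le> c"
  shows "inf (a + b) c \<le> inf a c + inf b c"
proof -
  let ?m = "inf (a + b) c"
  have "?m - b \<le> inf a c"
    using assms by (simp add: diff_le_eq le_infI1 le_infI2)
  then have 1: "?m - inf a c \<le> b"
    by (metis add.commute diff_le_eq)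
  have "?m \<le> c + inf a c"
    using assms by (simp add: add_increasing2 le_infI2)
  then have "?m - inf a c \<le> c"
    by (simp only: diff_le_eq)
  with 1 have "?m - inf a c \<le> inf b c"
    by (rule le_infI)
  then show ?thesis
    unfolding diff_le_eq by (simp only: add.commute)
qed

lemma abs_scaleR_le:
  fixes a :: "'a::vector_lattice"
  shows "\<bar>r *\<^sub>R a\<bar> \<le> \<bar>r\<bar> *\<^sub>R \<bar>a\<bar>"
proof (rule abs_leI)
  show "r *\<^sub>R a \<le> \<bar>r\<bar> *\<^sub>R \<bar>a\<bar>" 
    using scaleR_left_mono[of a "\<bar>a\<bar>" r] scaleR_left_mono[of "-a" "\<bar>a\<bar>" "-r"]
      abs_ge_self[of a] abs_ge_minus_self[of a]
    by (cases "0 \<le> r") auto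
  show "- (r *\<^sub>R a) \<le> \<bar>r\<bar> *\<^sub>R \<bar>a\<bar>"
    using scaleR_left_mono[of "-a" "\<bar>a\<bar>" r] scaleR_left_mono[of a "\<bar>a\<bar>" "-r"]
      abs_ge_self[of a] abs_ge_minus_self[of a]
    by (cases "0 \<le> r") auto
qed

lemma inf_scaleR_eq_0:
  fixes a b :: "'a::vector_lattice"
  assumes "0 \<le> a" "0 \<le> b" "inf a b = 0" "0 \<le> r"
  shows "inf (r *\<^sub>R a) b = 0"
proof -
  \<comment> \<open>A factor that is at least 1 enlarges \<open>b\<close> as well, so that it can be pulled out of the infimum.\<close>
  define R where "R = max r 1"
  have R: "0 < R" "r \<le> R" "1 \<le> R"
    unfolding R_def by linarith+
  let ?m = "inf (r *\<^sub>R a) b"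
  have "?m \<le> R *\<^sub>R a"
    using scaleR_right_mono[OF \<open>r \<le> R\<close> \<open>0 \<le> a\<close>] by (simp add: le_infI1)
  moreover have "?m \<le> R *\<^sub>R b"
    using scaleR_right_mono[OF \<open>1 \<le> R\<close> \<open>0 \<le> b\<close>] by (simp add: le_infI2)
  ultimately have "inverse R *\<^sub>R ?m \<le> inf a b"
    using R by (simp add: pos_divideR_le_eq)
  then have "?m \<le> 0"
    using R assms(3) by (simp add: pos_divideR_le_eq)
  moreover have "0 \<le> ?m"
    using assms by (simp add: scaleR_nonneg_nonneg)
  ultimately show ?thesis
    by (rule order_antisym)
qed

lemma pos_neg_part_disjoint: "inf (sup a 0) (sup (- a) 0) = (0::'a::vector_lattice)"
proof -
  have "sup (- a) 0 = sup a 0 + (- a)"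
    by (simp only: add_sup_distrib_right right_minus add_0_left sup_commute)
  then have "inf (sup a 0) (sup (- a) 0) = sup a 0 + inf 0 (- a)"
    by (simp only: add_inf_distrib_left add_0_right)
  also have "inf 0 (- a) = - sup a 0"
    by (simp only: neg_sup_eq_inf minus_zero inf_commute)
  finally show ?thesis
    by (simp only: right_minus)
qed

text \<open>
  The overlap of \<open>a\<^sup>+ = a + a\<^sup>-\<close> with \<open>c\<close> is at most \<open>(a \<and> c) + a\<^sup>- \<le> a\<^sup>-\<close>, and it is at most
  \<open>a\<^sup>+\<close>, which is disjoint from \<open>a\<^sup>-\<close>.
\<close>

lemma inf_pos_part_eq_0:
  fixes a c :: "'a::vector_lattice"
  assumes "0 \<le> c" "inf a c \<le> 0"
  shows "inf (sup a 0) c = 0"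
proof (rule order_antisym)
  let ?n = "sup (- a) 0"
  have "a + ?n = sup a 0"
    by (simp only: add_sup_distrib_left right_minus add_0_right sup_commute)
  moreover have "c \<le> c + ?n"
    by simp
  ultimately have "inf (sup a 0) c \<le> inf (a + ?n) (c + ?n)"
    by (simp only: inf_mono order_refl)
  also have "\<dots> = inf a c + ?n"
    by (simp only: add_inf_distrib_right)
  also have "\<dots> \<le> 0 + ?n"
    using assms(2) by (rule add_right_mono)
  finally have "inf (sup a 0) c \<le> ?n"
    by (simp only: add_0_left)
  then have "inf (sup a 0) c \<le> inf (sup a 0) ?n"
    by (rule le_infI[OF inf_le1])
  then show "inf (sup a 0) c \<le> 0"
    by (simp only: pos_neg_part_disjoint)
  show "0 \<le> inf (sup a 0) c"
    using assms(1) by simp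
qed

section \<open>Disjoint complements are bands\<close>

text \<open>
  A supremum cannot acquire an overlap that none of the elements has: if \<open>m\<close> is the overlap of
  \<open>s\<^sup>+\<close> with \<open>c\<close>, then each \<open>d\<^sup>+ + m = d\<^sup>+ \<squnion> m\<close> stays below \<open>s\<^sup>+\<close>, so that \<open>s\<^sup>+ - m\<close> is still an
  upper bound.
\<close>

lemma inf_pos_part_supremum_eq_0:
  fixes c s :: "'a::vector_lattice"
  assumes s: "is_supremum D s" and "0 \<le> c" and D: "\<And>d. d \<in> D \<Longrightarrow> inf (sup d 0) c = 0"
  shows "inf (sup s 0) c = 0"
proof -
  define m where "m = inf (sup s 0) c"
  have m: "0 \<le> m" "m \<le> sup s 0" "m \<le> c"
    using \<open>0 \<le> c\<close> by (auto simp: m_def)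
  have "d \<le> sup s 0 - m" if "d \<in> D" for d
  proof -
    have "inf (sup d 0) m \<le> inf (sup d 0) c"
      using m by (simp add: le_infI2)
    then have "inf (sup d 0) m = 0"
      using D[OF that] m by (simp add: order_antisym)
    then have "sup d 0 + m = sup (sup d 0) m"
      by (simp add: add_eq_inf_sup[of "sup d 0" m])
    also have "\<dots> \<le> sup s 0"
      using s that m by (auto simp: is_supremum_def le_supI1)
    finally have "sup d 0 \<le> sup s 0 - m"
      by (simp add: le_diff_eq)
    then show ?thesis
      by simp
  qed
  then have "s \<le> sup s 0 - m"
    using s by (simp add: is_supremum_def)
  then have "sup s 0 \<le> sup s 0 - m"
    using m by simp
  then have "m \<le> 0"
    by (simp only: le_diff_eq add_le_same_cancel1)
  then show ?thesis
    using m(1) unfolding m_def by (rule order_antisym)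
qed

lemma disjoint_complement_solid:
  assumes "y \<in> disjoint_complement S" "\<bar>x\<bar> \<le> \<bar>y\<bar>"
  shows "x \<in> disjoint_complement S"
proof -
  have "inf \<bar>x\<bar> \<bar>q\<bar> = 0" if "q \<in> S" for q
  proof -
    have "inf \<bar>x\<bar> \<bar>q\<bar> \<le> inf \<bar>y\<bar> \<bar>q\<bar>"
      using assms(2) by (simp add: le_infI1)
    also have "\<dots> = 0"
      using assms(1) that by (simp add: disjoint_complement_def)
    finally show ?thesis
      by (simp add: order_antisym)
  qed
  then show ?thesis
    by (simp add: disjoint_complement_def)
qed

lemma subspace_disjoint_complement: "subspace (disjoint_complement S)"
proof (rule subspaceI)
  show "0 \<in> disjoint_complement S"
    by (simp add: disjoint_complement_def inf_absorb1)
  fix x y assume xy: "x \<in> disjoint_complement S" "y \<in> disjoint_complement S"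
  have "inf \<bar>x + y\<bar> \<bar>q\<bar> = 0" if "q \<in> S" for q
  proof -
    have "inf \<bar>x + y\<bar> \<bar>q\<bar> \<le> inf (\<bar>x\<bar> + \<bar>y\<bar>) \<bar>q\<bar>"
      by (simp add: le_infI1 abs_triangle_ineq)
    also have "\<dots> \<le> inf \<bar>x\<bar> \<bar>q\<bar> + inf \<bar>y\<bar> \<bar>q\<bar>"
      by (simp add: inf_add_le)
    also have "\<dots> = 0"
      using xy that by (simp add: disjoint_complement_def)
    finally show ?thesis
      by (simp add: order_antisym)
  qed
  then show "x + y \<in> disjoint_complement S"
    by (simp add: disjoint_complement_def)
next
  fix r and x assume x: "x \<in> disjoint_complement S"
  have "inf \<bar>r *\<^sub>R x\<bar> \<bar>q\<bar> = 0" if "q \<in> S" for q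
  proof -
    have "inf \<bar>r *\<^sub>R x\<bar> \<bar>q\<bar> \<le> inf (\<bar>r\<bar> *\<^sub>R \<bar>x\<bar>) \<bar>q\<bar>"
      by (simp add: le_infI1 abs_scaleR_le)
    also have "\<dots> = 0"
      using x that by (intro inf_scaleR_eq_0) (simp_all add: disjoint_complement_def)
    finally show ?thesis
      by (simp add: order_antisym)
  qed
  then show "r *\<^sub>R x \<in> disjoint_complement S"
    by (simp add: disjoint_complement_def)
qed

text \<open>
  The supremum \<open>s\<close> of a set \<open>D\<close> need not be positive. Its negative part lies below the negative
  part of every element of \<open>D\<close>, so only the positive part needs the supremum property. An empty
  \<open>D\<close> has a supremum only in the zero space.
\<close>

lemma band_disjoint_complement: "band (disjoint_complement S)"
  unfolding band_def order_ideal_def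
proof (intro conjI allI impI)
  show "subspace (disjoint_complement S)"
    by (rule subspace_disjoint_complement)
  show "x \<in> disjoint_complement S" if "y \<in> disjoint_complement S" "\<bar>x\<bar> \<le> \<bar>y\<bar>" for x y
    using that by (rule disjoint_complement_solid)
  fix D and s :: 'a
  assume D: "D \<subseteq> disjoint_complement S" and s: "is_supremum D s"
  show "s \<in> disjoint_complement S"
  proof (cases "D = {}")
    case True
    then have "s \<le> s - \<bar>s\<bar>"
      using s unfolding is_supremum_def by blast
    then have "s = 0"
      by (simp add: le_diff_eq)
    then show ?thesis
      using subspace_0[OF subspace_disjoint_complement] by simp
  next
    case False
    then obtain d where d: "d \<in> D"
      by blast
    have "inf (sup s 0) \<bar>q\<bar> = 0" if "q \<in> S" for q
    proof (rule inf_pos_part_supremum_eq_0[OF s abs_ge_zero])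
      fix e assume "e \<in> D"
      then have "inf \<bar>e\<bar> \<bar>q\<bar> = 0"
        using D that by (auto simp: disjoint_complement_def)
      moreover have "inf (sup e 0) \<bar>q\<bar> \<le> inf \<bar>e\<bar> \<bar>q\<bar>"
        by (intro inf_mono) (simp_all add: abs_ge_self)
      ultimately show "inf (sup e 0) \<bar>q\<bar> = 0"
        by (simp add: order_antisym)
    qed
    then have pos: "sup s 0 \<in> disjoint_complement S"
      by (simp add: disjoint_complement_def)
    have "- s \<le> \<bar>d\<bar>"
      using s d abs_ge_minus_self[of d] unfolding is_supremum_def
      by (meson neg_le_iff_le order_trans)
    then have "\<bar>sup (- s) 0\<bar> \<le> \<bar>d\<bar>"
      by simp
    then have neg: "sup (- s) 0 \<in> disjoint_complement S"
      using D d by (blast intro: disjoint_complement_solid)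
    have "\<bar>s\<bar> \<le> sup s 0 + sup (- s) 0"
      by (rule abs_leI) (simp_all add: add_increasing add_increasing2)
    then have "\<bar>s\<bar> \<le> \<bar>sup s 0 + sup (- s) 0\<bar>"
      by simp
    then show ?thesis
      using subspace_add[OF subspace_disjoint_complement pos neg]
      by (rule disjoint_complement_solid[rotated])
  qed
qed

section \<open>Principal bands and band projections\<close>

lemma band_solid:
  assumes "band B" "y \<in> B" "0 \<le> x" "x \<le> y"
  shows "x \<in> B"
proof -
  have "\<bar>x\<bar> \<le> \<bar>y\<bar>"
    using assms by simp
  then show ?thesis
    using assms by (auto simp: band_def order_ideal_def)
qed

lemma band_subspace: "band B \<Longrightarrow> subspace B"
  by (simp add: band_def order_ideal_def)

lemma principal_band_self: "v \<in> principal_band v"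
  by (simp add: principal_band_def)

lemma principal_band_least: "band B \<Longrightarrow> v \<in> B \<Longrightarrow> principal_band v \<subseteq> B"
  by (auto simp: principal_band_def)

text \<open>
  Disjointness is symmetric: \<open>v\<close> lies in the band of all elements disjoint from \<open>a\<close>, hence so
  does everything in the principal band of \<open>v\<close>, and this includes \<open>a\<close>.
\<close>

lemma principal_band_disjoint_eq_0:
  assumes "a \<in> principal_band v" "a \<in> disjoint_complement {v}"
  shows "a = 0"
proof -
  have "v \<in> disjoint_complement {a}"
    using assms(2) by (simp add: disjoint_complement_def inf_commute)
  then have "a \<in> disjoint_complement {a}"
    using principal_band_least[OF band_disjoint_complement] assms(1) by blast
  then show ?thesis
    by (simp add: disjoint_complement_def)
qed

lemma band_projection_split:
  assumes "projection_band B"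
  shows "band_projection B x \<in> B" "x - band_projection B x \<in> disjoint_complement B"
  using theI'[of "\<lambda>y. y \<in> B \<and> x - y \<in> disjoint_complement B"] assms
  by (auto simp: projection_band_def band_projection_def)

lemma band_projection_unique:
  assumes "projection_band B" "y \<in> B" "x - y \<in> disjoint_complement B"
  shows "band_projection B x = y"
  using assms band_projection_split[OF assms(1), of x] unfolding projection_band_def by blast

lemma band_projection_diff:
  assumes B: "projection_band B"
  shows "band_projection B (x - y) = band_projection B x - band_projection B y"
proof (rule band_projection_unique[OF B])
  have sub: "subspace B"
    using B by (simp add: projection_band_def band_subspace)
  show "band_projection B x - band_projection B y \<in> B"
    using B by (intro subspace_diff[OF sub]) (simp_all add: band_projection_split)
  have "(x - band_projection B x) - (y - band_projection B y) \<in> disjoint_complement B"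
    using subspace_disjoint_complement band_projection_split(2)[OF B] band_projection_split(2)[OF B]
    by (rule subspace_diff)
  then show "x - y - (band_projection B x - band_projection B y) \<in> disjoint_complement B"
    by (simp add: algebra_simps)
qed

text \<open>
  If a sum of two disjoint elements is positive, the negative part of the first is dominated
  by the absolute values of both, hence vanishes.
\<close>

lemma disjoint_add_nonneg:
  fixes a b :: "'a::vector_lattice"
  assumes "inf \<bar>a\<bar> \<bar>b\<bar> = 0" "0 \<le> a + b"
  shows "0 \<le> a"
proof -
  have "- a \<le> b"
    using add_left_mono[OF assms(2), of "- a"] by simp
  then have "- a \<le> inf \<bar>a\<bar> \<bar>b\<bar>"
    using abs_ge_self[of b] abs_ge_minus_self[of a] order_trans by auto
  then show ?thesis
    using assms(1) by simp
qed

lemma band_projection_between: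
  assumes B: "projection_band B" and x: "0 \<le> x"
  shows "0 \<le> band_projection B x" "band_projection B x \<le> x"
proof -
  let ?y = "band_projection B x"
  have dis: "inf \<bar>x - ?y\<bar> \<bar>?y\<bar> = 0"
    using band_projection_split[OF B, of x] by (simp add: disjoint_complement_def)
  show "0 \<le> ?y"
    using dis x by (intro disjoint_add_nonneg[of ?y "x - ?y"]) (simp_all add: inf_commute)
  have "0 \<le> x - ?y"
    using dis x by (intro disjoint_add_nonneg[of "x - ?y" ?y]) simp_all
  then show "?y \<le> x"
    by simp
qed

lemma band_projection_mono:
  assumes "projection_band B" "x \<le> y"
  shows "band_projection B x \<le> band_projection B y"
    and "x - band_projection B x \<le> y - band_projection B y"
proof -
  have "0 \<le> y - x"
    using assms(2) by simp
  note between = band_projection_between[OF assms(1) this]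
  show "band_projection B x \<le> band_projection B y"
    using between(1) by (simp add: band_projection_diff[OF assms(1)])
  show "x - band_projection B x \<le> y - band_projection B y"
    using between(2) by (simp add: band_projection_diff[OF assms(1)] algebra_simps)
qed

lemma band_projection_is_component:
  assumes "projection_band B" "0 \<le> u"
  shows "is_component u (band_projection B u)"
  using band_projection_split[OF assms(1), of u] band_projection_between[OF assms]
  by (auto simp: is_component_def disjoint_complement_def inf_commute)

section \<open>Unbounded order convergence and small projections\<close>

text \<open>
  Below \<open>2\<epsilon>v\<close> the element \<open>y\<close> is controlled by \<open>w\<close>, and \<open>w \<le> \<epsilon>u\<close> holds on the band of
  \<open>(\<epsilon>u - w)\<^sup>+\<close>. Having \<open>2\<epsilon>\<close> rather than \<open>\<epsilon>\<close> in the truncation leaves the room that makes the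
  excess of \<open>y\<close> over \<open>\<epsilon>v\<close> visible.
\<close>

lemma truncated_bound_on_band:
  fixes u v w y z :: "'a::vector_lattice" and \<epsilon> :: real
  defines "z \<equiv> sup (\<epsilon> *\<^sub>R u - w) 0"
  assumes Bz: "projection_band (principal_band z)"
    and v: "v = band_projection (principal_band z) u"
    and u: "0 \<le> u" and eps: "0 < \<epsilon>"
    and y: "0 \<le> y" "y \<in> principal_band v"
    and trunc: "inf y ((2 * \<epsilon>) *\<^sub>R u) \<le> w"
  shows "y \<le> \<epsilon> *\<^sub>R v"
proof -
  have vB: "v \<in> principal_band z"
    using v band_projection_split[OF Bz] by simp
  have v_between: "0 \<le> v" "v \<le> u"
    using v band_projection_between[OF Bz u] by simp_all
  have band_z: "band (principal_band z)"
    using Bz by (simp add: projection_band_def)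
  \<comment> \<open>\<open>t\<^sup>+\<close> is zero because it lies in the band of \<open>z\<close> and is disjoint from \<open>z\<close>: it is at most
    \<open>(w - \<epsilon>u)\<^sup>+ + \<epsilon>(u - v)\<close>, where the first term is the negative part of \<open>\<epsilon>u - w\<close>, whose
    positive part is \<open>z\<close>, and \<open>u - v\<close> is the remainder of the projection.\<close>
  define t where "t = inf y ((2 * \<epsilon>) *\<^sub>R v) - \<epsilon> *\<^sub>R v"
  have "sup t 0 \<in> principal_band z"
  proof (rule band_solid[OF band_z])
    show "y \<in> principal_band z"
      using principal_band_least[OF band_z vB] y by blast
    have "0 \<le> \<epsilon> *\<^sub>R v"
      using eps v_between by (simp add: scaleR_nonneg_nonneg)
    then have "t \<le> inf y ((2 * \<epsilon>) *\<^sub>R v)"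
      unfolding t_def diff_le_eq by (rule add_increasing2[OF _ order_refl])
    then show "sup t 0 \<le> y"
      using y by simp
  qed simp
  moreover have "sup t 0 \<in> disjoint_complement {z}"
  proof -
    have 1: "sup (- (\<epsilon> *\<^sub>R u - w)) 0 \<in> disjoint_complement {z}"
      using pos_neg_part_disjoint[of "\<epsilon> *\<^sub>R u - w"]
      by (simp add: disjoint_complement_def z_def inf_commute)
    have "u - v \<in> disjoint_complement {z}"
      using band_projection_split(2)[OF Bz, of u] principal_band_self[of z] v
      by (simp add: disjoint_complement_def)
    then have 2: "\<epsilon> *\<^sub>R (u - v) \<in> disjoint_complement {z}"
      by (rule subspace_scale[OF subspace_disjoint_complement])
    have "inf y ((2 * \<epsilon>) *\<^sub>R v) \<le> inf y ((2 * \<epsilon>) *\<^sub>R u)"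
      using v_between eps by (simp add: le_infI2 scaleR_left_mono)
    then have "t \<le> w - \<epsilon> *\<^sub>R v"
      unfolding t_def by (intro diff_right_mono order_trans[OF _ trunc])
    also have "\<dots> = - (\<epsilon> *\<^sub>R u - w) + \<epsilon> *\<^sub>R (u - v)"
      by (simp add: algebra_simps)
    also have "\<dots> \<le> sup (- (\<epsilon> *\<^sub>R u - w)) 0 + \<epsilon> *\<^sub>R (u - v)"
      by (intro add_right_mono) simp
    finally have "t \<le> sup (- (\<epsilon> *\<^sub>R u - w)) 0 + \<epsilon> *\<^sub>R (u - v)" .
    moreover have "0 \<le> sup (- (\<epsilon> *\<^sub>R u - w)) 0 + \<epsilon> *\<^sub>R (u - v)"
      using v_between eps by (intro add_nonneg_nonneg scaleR_nonneg_nonneg) simp_all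
    ultimately show ?thesis
      by (intro band_solid[OF band_disjoint_complement
            subspace_add[OF subspace_disjoint_complement 1 2]]) simp_all
  qed
  ultimately have "sup t 0 = 0"
    by (rule principal_band_disjoint_eq_0)
  then have t_le: "t \<le> 0"
    by (metis sup_ge1)
  have t_eq: "t = inf (y - \<epsilon> *\<^sub>R v) (\<epsilon> *\<^sub>R v)"
  proof -
    have "t = inf (y - \<epsilon> *\<^sub>R v) ((2 * \<epsilon>) *\<^sub>R v - \<epsilon> *\<^sub>R v)"
      using add_inf_distrib_right[of y "(2 * \<epsilon>) *\<^sub>R v" "- (\<epsilon> *\<^sub>R v)"] by (simp add: t_def)
    then show ?thesis
      by (simp flip: scaleR_left_diff_distrib)
  qed
  \<comment> \<open>The excess \<open>q\<close> of \<open>y\<close> over \<open>\<epsilon>v\<close> meets \<open>\<epsilon>v\<close> in \<open>t\<^sup>+ = 0\<close>, but \<open>q \<le> y\<close> puts it in the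
    band of \<open>v\<close>.\<close>
  define q where "q = sup (y - \<epsilon> *\<^sub>R v) 0"
  have ev: "0 \<le> \<epsilon> *\<^sub>R v"
    using eps v_between by (simp add: scaleR_nonneg_nonneg)
  have "inf q (\<epsilon> *\<^sub>R v) = 0"
    unfolding q_def using ev t_le t_eq by (intro inf_pos_part_eq_0) simp_all
  then have "\<epsilon> *\<^sub>R v \<in> disjoint_complement {q}"
    using ev by (simp add: disjoint_complement_def q_def inf_commute)
  then have "inverse \<epsilon> *\<^sub>R (\<epsilon> *\<^sub>R v) \<in> disjoint_complement {q}"
    by (rule subspace_scale[OF subspace_disjoint_complement])
  then have "v \<in> disjoint_complement {q}"
    using eps by simp
  then have "y \<in> disjoint_complement {q}"
    using principal_band_least[OF band_disjoint_complement] y by blast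
  moreover have "0 \<le> q"
    by (simp add: q_def)
  moreover have "q \<le> y"
    unfolding q_def using y(1)
    by (rule le_supI[rotated]) (simp only: diff_le_eq add_increasing2[OF ev order_refl])
  ultimately have "q \<in> disjoint_complement {q}"
    by (rule band_solid[OF band_disjoint_complement])
  then have "q = 0"
    by (simp add: disjoint_complement_def)
  then have "y - \<epsilon> *\<^sub>R v \<le> 0"
    unfolding q_def by (metis sup_ge1)
  then show ?thesis
    by (simp only: diff_le_0_iff_le)
qed

lemma uo_null_imp_small_projection:
  fixes x :: "'i \<Rightarrow> 'a::vector_lattice"
  assumes ppp: "principal_projection_property TYPE('a)"
    and pos: "\<forall>\<alpha>\<in>A. 0 \<le> x \<alpha>"
    and conv: "uo_converges A le x 0"
    and u: "0 < u" and eps: "0 < (\<epsilon>::real)"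
  shows "\<exists>v. is_component u v \<and> v \<noteq> 0 \<and>
    (\<exists>\<alpha>\<^sub>0\<in>A. \<forall>\<alpha>\<in>A. le \<alpha>\<^sub>0 \<alpha> \<longrightarrow> band_projection (principal_band v) (x \<alpha>) \<le> \<epsilon> *\<^sub>R u)"
proof -
  have proj: "projection_band (principal_band a)" for a :: 'a
    using ppp by (simp add: principal_projection_property_def)
  have "0 \<le> (2 * \<epsilon>) *\<^sub>R u"
    using u eps by (simp add: scaleR_nonneg_nonneg)
  with conv obtain G :: "'a set" and leG w where
    dec: "net_decreases_to G leG w 0" and
    dom: "net_dominated A le (\<lambda>\<alpha>. inf \<bar>x \<alpha> - 0\<bar> ((2 * \<epsilon>) *\<^sub>R u)) 0 G w"
    unfolding uo_converges_def order_converges_def by blast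
  \<comment> \<open>Otherwise \<open>\<epsilon>u\<close> would be a positive lower bound of a net with infimum zero.\<close>
  have "\<exists>\<gamma>\<in>G. \<not> \<epsilon> *\<^sub>R u \<le> w \<gamma>"
  proof (rule ccontr)
    assume "\<not> ?thesis"
    then have "\<epsilon> *\<^sub>R u \<le> 0"
      using dec by (auto simp: net_decreases_to_def is_infimum_def)
    then have "inverse \<epsilon> *\<^sub>R (\<epsilon> *\<^sub>R u) \<le> inverse \<epsilon> *\<^sub>R 0"
      using eps by (intro scaleR_left_mono) simp_all
    then show False
      using u eps by simp
  qed
  then obtain \<gamma> where \<gamma>: "\<gamma> \<in> G" "\<not> \<epsilon> *\<^sub>R u \<le> w \<gamma>"
    by blast
  obtain \<alpha>\<^sub>0 where \<alpha>\<^sub>0: "\<alpha>\<^sub>0 \<in> A"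
    "\<And>\<alpha>. \<alpha> \<in> A \<Longrightarrow> le \<alpha>\<^sub>0 \<alpha> \<Longrightarrow> \<bar>inf \<bar>x \<alpha> - 0\<bar> ((2 * \<epsilon>) *\<^sub>R u) - 0\<bar> \<le> w \<gamma>"
    using dom \<gamma>(1) unfolding net_dominated_def by blast
  define z where "z = sup (\<epsilon> *\<^sub>R u - w \<gamma>) 0"
  define v where "v = band_projection (principal_band z) u"
  have "z \<noteq> 0"
    using \<gamma>(2) unfolding z_def by (metis sup_ge1 diff_le_0_iff_le)
  have comp: "is_component u v"
    unfolding v_def using u by (intro band_projection_is_component[OF proj]) simp
  have "v \<noteq> 0"
  proof
    assume "v = 0"
    then have "u \<in> disjoint_complement {z}"
      using band_projection_split(2)[OF proj, of u z] principal_band_self[of z]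
      by (simp add: v_def disjoint_complement_def)
    then have eu: "\<epsilon> *\<^sub>R u \<in> disjoint_complement {z}"
      by (rule subspace_scale[OF subspace_disjoint_complement])
    have "0 \<le> w \<gamma>"
      using dec \<gamma>(1) by (simp add: net_decreases_to_def is_infimum_def)
    then have "z \<le> \<epsilon> *\<^sub>R u" "0 \<le> z"
      using u eps by (simp_all add: z_def scaleR_nonneg_nonneg)
    then have "z \<in> disjoint_complement {z}"
      using band_solid[OF band_disjoint_complement eu] by blast
    with \<open>z \<noteq> 0\<close> show False
      by (simp add: disjoint_complement_def)
  qed
  moreover have "band_projection (principal_band v) (x \<alpha>) \<le> \<epsilon> *\<^sub>R u"
    if "\<alpha> \<in> A" "le \<alpha>\<^sub>0 \<alpha>" for \<alpha>
  proof -
    let ?y = "band_projection (principal_band v) (x \<alpha>)"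
    have x: "0 \<le> x \<alpha>"
      using pos that by blast
    note y = band_projection_between[OF proj[of v] x]
    have "inf ?y ((2 * \<epsilon>) *\<^sub>R u) \<le> inf (x \<alpha>) ((2 * \<epsilon>) *\<^sub>R u)"
      using y by (simp add: le_infI1)
    also have "\<dots> \<le> w \<gamma>"
      using \<alpha>\<^sub>0(2)[OF that] x abs_ge_self order_trans by fastforce
    finally have "?y \<le> \<epsilon> *\<^sub>R v"
      using y u eps proj unfolding z_def v_def
      by (intro truncated_bound_on_band[where w = "w \<gamma>" and u = u])
        (simp_all add: band_projection_split)
    also have "\<dots> \<le> \<epsilon> *\<^sub>R u"
      using comp eps by (simp add: is_component_def scaleR_left_mono)
    finally show ?thesis .
  qed
  ultimately show ?thesis
    using comp \<alpha>\<^sub>0(1) by blast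
qed

lemma small_projection_imp_uo_null:
  fixes x :: "'i \<Rightarrow> 'a::vector_lattice"
  assumes ppp: "principal_projection_property TYPE('a)"
    and dir: "directed_set A le"
    and pos: "\<forall>\<alpha>\<in>A. 0 \<le> x \<alpha>"
    and small: "\<And>(u::'a) \<epsilon>::real. 0 < u \<Longrightarrow> 0 < \<epsilon> \<Longrightarrow> \<exists>v. is_component u v \<and> v \<noteq> 0 \<and>
      (\<exists>\<alpha>\<^sub>0\<in>A. \<forall>\<alpha>\<in>A. le \<alpha>\<^sub>0 \<alpha> \<longrightarrow> band_projection (principal_band v) (x \<alpha>) \<le> \<epsilon> *\<^sub>R u)"
  shows "uo_converges A le x 0"
  unfolding uo_converges_def
proof (intro allI impI)
  fix u :: 'a assume u: "0 \<le> u"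
  have proj: "projection_band (principal_band a)" for a :: 'a
    using ppp by (simp add: principal_projection_property_def)
  define G where "G = {g. 0 \<le> g \<and> (\<exists>\<alpha>\<^sub>0\<in>A. \<forall>\<alpha>\<in>A. le \<alpha>\<^sub>0 \<alpha> \<longrightarrow> inf (x \<alpha>) u \<le> g)}"
  have G_inf: "inf g h \<in> G" if gh: "g \<in> G" "h \<in> G" for g h
  proof -
    obtain \<beta> \<gamma> where bc: "\<beta> \<in> A" "\<gamma> \<in> A"
      "\<And>\<alpha>. \<alpha> \<in> A \<Longrightarrow> le \<beta> \<alpha> \<Longrightarrow> inf (x \<alpha>) u \<le> g" "\<And>\<alpha>. \<alpha> \<in> A \<Longrightarrow> le \<gamma> \<alpha> \<Longrightarrow> inf (x \<alpha>) u \<le> h"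
      using gh unfolding G_def by blast
    obtain \<delta> where \<delta>: "\<delta> \<in> A" "le \<beta> \<delta>" "le \<gamma> \<delta>"
      using dir bc(1,2) unfolding directed_set_def by blast
    have "inf (x \<alpha>) u \<le> inf g h" if a: "\<alpha> \<in> A" "le \<delta> \<alpha>" for \<alpha>
    proof -
      have "le \<beta> \<alpha>" "le \<gamma> \<alpha>"
        using dir a \<delta> bc(1,2) unfolding directed_set_def by (blast dest: transp_onD)+
      then show ?thesis
        using bc(3,4) a(1) by simp
    qed
    then show ?thesis
      using gh \<delta>(1) unfolding G_def by auto
  qed
  have "u \<in> G"
    using u dir by (auto simp: G_def directed_set_def)
  have "directed_set G (\<lambda>a b. b \<le> a)"
    unfolding directed_set_def
  proof (intro conjI ballI)
    show "\<exists>k\<in>G. k \<le> g \<and> k \<le> h" if "g \<in> G" "h \<in> G" for g h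
      using G_inf[OF that] by (intro bexI[of _ "inf g h"]) simp_all
  qed (use \<open>u \<in> G\<close> in \<open>auto simp: reflp_on_def transp_on_def\<close>)
  moreover have "is_infimum G 0"
    unfolding is_infimum_def
  proof (intro conjI allI impI)
    show "\<forall>g\<in>G. 0 \<le> g"
      by (simp add: G_def)
    fix l assume l: "\<forall>g\<in>G. l \<le> g"
    define h where "h = sup l 0"
    have h: "h \<le> g" if "g \<in> G" for g
      using l that by (simp add: h_def G_def)
    have "h = 0"
    proof (rule ccontr)
      assume "h \<noteq> 0"
      then have "0 < h"
        by (simp add: h_def order.strict_iff_order)
      then obtain v \<alpha>\<^sub>0 where v: "is_component h v" "v \<noteq> 0" and \<alpha>\<^sub>0: "\<alpha>\<^sub>0 \<in> A" and
        small_v: "\<And>\<alpha>. \<alpha> \<in> A \<Longrightarrow> le \<alpha>\<^sub>0 \<alpha> \<Longrightarrow>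
          band_projection (principal_band v) (x \<alpha>) \<le> (1 / 2) *\<^sub>R h"
        using small[of h "1 / 2"] by auto
      let ?P = "band_projection (principal_band v)"
      \<comment> \<open>Split \<open>x\<^sub>\<alpha> \<and> u\<close> along the band of \<open>v\<close>: the part inside is bounded by that of \<open>x\<^sub>\<alpha>\<close>, the
        part outside by that of \<open>u\<close>.\<close>
      have "inf (x \<alpha>) u \<le> (1 / 2) *\<^sub>R h + (u - ?P u)" if "\<alpha> \<in> A" "le \<alpha>\<^sub>0 \<alpha>" for \<alpha>
      proof -
        have "?P (inf (x \<alpha>) u) \<le> ?P (x \<alpha>)"
          by (intro band_projection_mono[OF proj]) simp
        also have "\<dots> \<le> (1 / 2) *\<^sub>R h"
          using small_v that .
        finally have "?P (inf (x \<alpha>) u) + (inf (x \<alpha>) u - ?P (inf (x \<alpha>) u))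
            \<le> (1 / 2) *\<^sub>R h + (u - ?P u)"
          by (intro add_mono band_projection_mono[OF proj]) simp_all
        then show ?thesis
          by simp
      qed
      moreover have "0 \<le> (1 / 2) *\<^sub>R h + (u - ?P u)"
        using \<open>0 < h\<close> band_projection_between[OF proj u]
        by (intro add_nonneg_nonneg scaleR_nonneg_nonneg) simp_all
      ultimately have "h \<le> (1 / 2) *\<^sub>R h + (u - ?P u)"
        using \<alpha>\<^sub>0 by (intro h) (auto simp: G_def)
      then have "h - (1 / 2) *\<^sub>R h \<le> u - ?P u"
        by (simp add: algebra_simps)
      moreover have "h - (1 / 2) *\<^sub>R h = (1 / 2) *\<^sub>R h"
        using scaleR_left_diff_distrib[of 1 "1 / 2" h] by simp
      ultimately have half: "(1 / 2) *\<^sub>R h \<le> u - ?P u"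
        by simp
      have rest: "u - ?P u \<in> disjoint_complement {v}"
        using band_projection_split(2)[OF proj, of u v] principal_band_self[of v]
        by (simp add: disjoint_complement_def)
      then have "(1 / 2) *\<^sub>R h \<in> disjoint_complement {v}"
        using half \<open>0 < h\<close>
        by (intro band_solid[OF band_disjoint_complement rest])
          (simp_all add: scaleR_nonneg_nonneg)
      then have "2 *\<^sub>R ((1 / 2) *\<^sub>R h) \<in> disjoint_complement {v}"
        by (rule subspace_scale[OF subspace_disjoint_complement])
      then have "h \<in> disjoint_complement {v}"
        by simp
      then have "v \<in> disjoint_complement {v}"
        using v(1) band_solid[OF band_disjoint_complement] unfolding is_component_def by blast
      with v(2) show False
        by (simp add: disjoint_complement_def)
    qed
    then show "l \<le> 0"
      unfolding h_def by (metis sup_ge1)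
  qed
  ultimately have "net_decreases_to G (\<lambda>a b. b \<le> a) (\<lambda>a. a) 0"
    by (simp add: net_decreases_to_def)
  moreover have "net_dominated A le (\<lambda>\<alpha>. inf \<bar>x \<alpha> - 0\<bar> u) 0 G (\<lambda>a. a)"
    unfolding net_dominated_def
  proof
    fix g assume "g \<in> G"
    then obtain \<alpha>\<^sub>0 where "\<alpha>\<^sub>0 \<in> A" "\<And>\<alpha>. \<alpha> \<in> A \<Longrightarrow> le \<alpha>\<^sub>0 \<alpha> \<Longrightarrow> inf (x \<alpha>) u \<le> g"
      unfolding G_def by blast
    moreover have "\<bar>inf \<bar>x \<alpha> - 0\<bar> u - 0\<bar> = inf (x \<alpha>) u" if "\<alpha> \<in> A" for \<alpha>
      using pos u that by simp
    ultimately show "\<exists>\<alpha>\<^sub>0\<in>A. \<forall>\<alpha>\<in>A. le \<alpha>\<^sub>0 \<alpha> \<longrightarrow> \<bar>inf \<bar>x \<alpha> - 0\<bar> u - 0\<bar> \<le> g"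
      by (intro bexI[of _ \<alpha>\<^sub>0]) simp_all
  qed
  ultimately show "order_converges A le (\<lambda>\<alpha>. inf \<bar>x \<alpha> - 0\<bar> u) 0"
    by (rule order_convergesI)
qed

theorem theorem5p1:
  fixes A :: "'i set" and le :: "'i \<Rightarrow> 'i \<Rightarrow> bool" and x :: "'i \<Rightarrow> 'a::vector_lattice"
  assumes "archimedean_vl TYPE('a)"
    and "principal_projection_property TYPE('a)"
    and "directed_set A le"
    and "\<forall>\<alpha>\<in>A. 0 \<le> x \<alpha>"
  shows "uo_converges A le x 0 \<longleftrightarrow>
    (\<forall>u::'a. 0 < u \<longrightarrow> (\<forall>\<epsilon>::real. 0 < \<epsilon> \<longrightarrow>
      (\<exists>v. is_component u v \<and> v \<noteq> 0 \<and>
        (\<exists>\<alpha>\<^sub>0\<in>A. \<forall>\<alpha>\<in>A. le \<alpha>\<^sub>0 \<alpha> \<longrightarrow>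
          band_projection (principal_band v) (x \<alpha>) \<le> \<epsilon> *\<^sub>R u))))"
proof (intro iffI allI impI)
  fix u :: 'a and \<epsilon> :: real
  assume "uo_converges A le x 0" "0 < u" "0 < \<epsilon>"
  then show "\<exists>v. is_component u v \<and> v \<noteq> 0 \<and> (\<exists>\<alpha>\<^sub>0\<in>A. \<forall>\<alpha>\<in>A. le \<alpha>\<^sub>0 \<alpha> \<longrightarrow>
      band_projection (principal_band v) (x \<alpha>) \<le> \<epsilon> *\<^sub>R u)"
    by (rule uo_null_imp_small_projection[OF assms(2,4)])
next
  assume "\<forall>u::'a. 0 < u \<longrightarrow> (\<forall>\<epsilon>::real. 0 < \<epsilon> \<longrightarrow> (\<exists>v. is_component u v \<and> v \<noteq> 0 \<and>
      (\<exists>\<alpha>\<^sub>0\<in>A. \<forall>\<alpha>\<in>A. le \<alpha>\<^sub>0 \<alpha> \<longrightarrow>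
        band_projection (principal_band v) (x \<alpha>) \<le> \<epsilon> *\<^sub>R u)))"
  then show "uo_converges A le x 0"
    by (intro small_projection_imp_uo_null[OF assms(2-4)]) simp
qed

end
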